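(* Let $G$ be a graph in $\varepsilon_3$. Then every block of $G$ is a cycle $C_n$ with $n\equiv 3 \pmod 4$.
   Context: All graphs are finite, simple, undirected and connected. An Euler graph is a connected graph in which every vertex has even degree. $\varepsilon_3$ denotes the class of Euler graphs $G$ such that every cycle of $G$ has length $n\equiv 3 \pmod 4$. A block is a maximal connected subgraph without cut vertices.
   Formalization: The graph G is additionally assumed to have at least two vertices: the one-vertex graph literally belongs to the class (degree 0, no cycles), but its only block is a single vertex, not a cycle. *)

theory Defs
  imports "Graph_Theory.Graph_Theory"
begin

text \<open>
  A finite simple undirected graph is rendered by the locale \<open>graph\<close> of \<open>Graph_Theory\<close>: a finite
  symmetric digraph without loops and parallel arcs, in which an undirected edge is a pair of
  mutually reverse arcs. Hence the degree of a vertex is its out-degree, the strongly connected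
  components are the connected components, and an undirected subgraph is a subdigraph that
  satisfies \<open>graph\<close> itself.
\<close>

definition euler_graph :: "('a, 'b) pre_digraph \<Rightarrow> bool" where
  "euler_graph G \<longleftrightarrow> graph G \<and> Digraph_Component.connected G \<and>
     (\<forall>v \<in> verts G. even (out_degree G v))"

text \<open>
  In a symmetric digraph the closed walk \<open>u, v, u\<close> along a single edge satisfies
  \<open>pre_digraph.cycle\<close>; it is not a cycle of the undirected graph.
\<close>

definition ucycle :: "('a, 'b) pre_digraph \<Rightarrow> 'b awalk \<Rightarrow> bool" where
  "ucycle G p \<longleftrightarrow> pre_digraph.cycle G p \<and> 3 \<le> length p"

definition euler_graphs_3 :: "('a, 'b) pre_digraph set" where
  "euler_graphs_3 = {G. euler_graph G \<and> (\<forall>p. ucycle G p \<longrightarrow> length p mod 4 = 3)}"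

definition cut_vertex :: "('a, 'b) pre_digraph \<Rightarrow> 'a \<Rightarrow> bool" where
  "cut_vertex G v \<longleftrightarrow> v \<in> verts G \<and>
     card (pre_digraph.sccs G) < card (pre_digraph.sccs (pre_digraph.del_vert G v))"

definition block :: "('a, 'b) pre_digraph \<Rightarrow> ('a, 'b) pre_digraph \<Rightarrow> bool" where
  "block B G \<longleftrightarrow> pre_digraph.max_subgraph G
     (\<lambda>H. graph H \<and> Digraph_Component.connected H \<and> (\<nexists>v. cut_vertex H v)) B"

text \<open>The cycle \<open>C\<^sub>n\<close>; meaningful for \<open>n \<ge> 3\<close> only.\<close>

definition cycle_graph :: "nat \<Rightarrow> (nat, nat \<times> nat) pre_digraph" where
  "cycle_graph n = with_proj
     \<lparr> pverts = {..<n},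
       parcs = {(i, j). i < n \<and> j < n \<and> (j = Suc i mod n \<or> i = Suc j mod n)} \<rparr>"

end

theory Submission
  imports Defs
begin

text \<open>
  Since all degrees are even, no edge is a bridge: deleting an edge \<open>uv\<close> leaves two odd vertices,
  which the handshake lemma puts into the same component. Hence every edge lies on a cycle, and
  adjoining to a block a cycle through one of its edges (or through its only vertex) keeps it free
  of cut vertices, so by maximality every block is an induced subgraph that contains a cycle \<open>C\<close>. A vertex of the block
  outside \<open>C\<close>, or a chord of \<open>C\<close>, would give three internally disjoint paths of lengths \<open>p\<close>, \<open>q\<close>,
  \<open>r\<close> between two vertices of \<open>C\<close>. Then \<open>p + q\<close>, \<open>q + r\<close> and \<open>p + r\<close> are all \<open>3\<close> modulo \<open>4\<close>, so
  \<open>2p\<close> is congruent to \<open>3\<close>, which is impossible.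
\<close>

section \<open>Connectivity, paths and cycles in a relation\<close>

definition connected_on :: "'a rel \<Rightarrow> 'a set \<Rightarrow> bool" where
  "connected_on E A \<longleftrightarrow> A \<times> A \<subseteq> (Restr E A)\<^sup>*"

text \<open>The empty set passes \<open>connected_on\<close>, so singletons are biconnected. This
  agrees with \<open>cut_vertex\<close>: deleting the only vertex leaves no component, hence does
  not raise their number.\<close>

definition biconnected_on :: "'a rel \<Rightarrow> 'a set \<Rightarrow> bool" where
  "biconnected_on E A \<longleftrightarrow> connected_on E A \<and> (\<forall>x. connected_on E (A - {x}))"

definition path_in :: "'a rel \<Rightarrow> 'a list \<Rightarrow> bool" where
  "path_in E xs \<longleftrightarrow> distinct xs \<and> successively (\<lambda>x y. (x, y) \<in> E) xs"

text \<open>The first vertex is not repeated at the end, so \<open>length xs\<close> is the length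
  of the cycle.\<close>

definition cycle_in :: "'a rel \<Rightarrow> 'a list \<Rightarrow> bool" where
  "cycle_in E xs \<longleftrightarrow> 3 \<le> length xs \<and> path_in E xs \<and> (last xs, hd xs) \<in> E"

lemma connected_onD:
  assumes "connected_on E A" "x \<in> A" "y \<in> A"
  shows "(x, y) \<in> (Restr E A)\<^sup>*"
  using assms by (auto simp: connected_on_def)

lemma Restr_rtrancl_mono:
  assumes "(x, y) \<in> (Restr E A)\<^sup>*" "A \<subseteq> B" "E \<subseteq> F"
  shows "(x, y) \<in> (Restr F B)\<^sup>*"
proof -
  have "Restr E A \<subseteq> Restr F B" using assms by auto
  then show ?thesis using assms(1) rtrancl_mono by blast
qed

lemma connected_on_mono:
  assumes "connected_on E A" "E \<subseteq> F"
  shows "connected_on F A"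
  using assms Restr_rtrancl_mono[of _ _ E A A F] by (auto simp: connected_on_def)

lemma connected_on_Un:
  assumes A: "connected_on E A" and B: "connected_on E B" and z: "z \<in> A" "z \<in> B"
  shows "connected_on E (A \<union> B)"
proof -
  let ?R = "(Restr E (A \<union> B))\<^sup>*"
  have to_z: "(x, z) \<in> ?R \<and> (z, x) \<in> ?R" if "x \<in> A \<union> B" for x
    using that connected_onD[OF A] connected_onD[OF B] z
      Restr_rtrancl_mono[of _ _ E A "A \<union> B" E] Restr_rtrancl_mono[of _ _ E B "A \<union> B" E]
    by blast
  show ?thesis unfolding connected_on_def
    using to_z by (blast intro: rtrancl_trans)
qed

lemma connected_on_successively:
  assumes "sym E" "successively (\<lambda>x y. (x, y) \<in> E) xs"
  shows "connected_on E (set xs)"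
  using assms(2)
proof (induction xs rule: induct_list012)
  case (3 x y zs)
  have "connected_on E {x, y}"
  proof -
    have "(x, y) \<in> E" "(y, x) \<in> E" using 3 assms(1) by (auto dest: symD)
    then show ?thesis by (auto simp: connected_on_def intro!: r_into_rtrancl)
  qed
  moreover have "connected_on E (set (y # zs))" using 3 by auto
  ultimately have "connected_on E ({x, y} \<union> set (y # zs))"
    by (rule connected_on_Un[where z = y]) auto
  then show ?case by (simp add: insert_commute insert_absorb)
qed (auto simp: connected_on_def)

lemma cycle_in_rotate:
  assumes "cycle_in E (xs @ ys)"
  shows "cycle_in E (ys @ xs)"
proof (cases "xs = [] \<or> ys = []")
  case False
  then show ?thesis using assms
    by (auto simp: cycle_in_def path_in_def successively_append_iff)
qed (use assms in auto)

lemma cycle_in_rotate_hd: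
  assumes "cycle_in E C" "x \<in> set C"
  obtains D where "cycle_in E (x # D)" "set (x # D) = set C" "length (x # D) = length C"
proof -
  obtain ys zs where C: "C = ys @ x # zs" using assms(2) by (auto simp: in_set_conv_decomp)
  show thesis
    using cycle_in_rotate[of E ys "x # zs"] assms(1) that[of "zs @ ys"] C by auto
qed

text \<open>Rotating the deleted vertex to the front shows that the other vertices form a
  path.\<close>

lemma biconnected_on_cycle:
  assumes "sym E" "cycle_in E C"
  shows "biconnected_on E (set C)"
  unfolding biconnected_on_def
proof (intro conjI allI)
  show conn: "connected_on E (set C)"
    using assms by (auto simp: cycle_in_def path_in_def intro: connected_on_successively)
  fix x
  show "connected_on E (set C - {x})"
  proof (cases "x \<in> set C")
    case True
    then obtain D where D: "cycle_in E (x # D)" "set (x # D) = set C"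
      using cycle_in_rotate_hd assms(2) by metis
    then have "connected_on E (set D)"
      using assms(1)
      by (auto simp: cycle_in_def path_in_def successively_Cons intro: connected_on_successively)
    moreover have "set C - {x} = set D"
      using D by (auto simp: cycle_in_def path_in_def)
    ultimately show ?thesis by simp
  qed (use conn in auto)
qed

text \<open>After deletion of \<open>x\<close> the two sets still share an element, unless
  \<open>A - {x}\<close> is empty: two common elements cannot both be \<open>x\<close>, and if
  \<open>A = {u}\<close> then \<open>u\<close> itself is shared as long as
  \<open>x \<noteq> u\<close>.\<close>

lemma biconnected_on_Un_cycle:
  assumes "sym E" "biconnected_on E A" "cycle_in E C" "u \<in> A" "u \<in> set C"
    and meet: "A = {u} \<or> (\<exists>w \<in> A \<inter> set C. w \<noteq> u)"
  shows "biconnected_on E (A \<union> set C)"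
proof -
  have C: "biconnected_on E (set C)" using biconnected_on_cycle assms by blast
  have "connected_on E ((A - {x}) \<union> (set C - {x}))" for x
  proof (cases "A - {x} = {}")
    case True
    then show ?thesis using C by (metis biconnected_on_def sup_bot_left)
  next
    case False
    then obtain z where "z \<in> A - {x}" "z \<in> set C - {x}"
      using meet assms(4,5) by blast
    then show ?thesis
      using assms(2) C connected_on_Un[of E "A - {x}" "set C - {x}" z] by (auto simp: biconnected_on_def)
  qed
  moreover have "connected_on E (A \<union> set C)"
    using assms(2) C connected_on_Un[of E A "set C" u] assms(4,5) by (auto simp: biconnected_on_def)
  ultimately show ?thesis by (simp add: biconnected_on_def Un_Diff)
qed

section \<open>Paths stopped at their first visit to a set\<close>

lemma path_to_set:
  assumes "(x, y) \<in> R\<^sup>*" "y \<in> Y"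
  obtains p z where "path_in R (p @ [z])" "hd (p @ [z]) = x" "z \<in> Y" "set p \<inter> Y = {}"
proof -
  have "\<exists>p z. path_in R (p @ [z]) \<and> hd (p @ [z]) = x \<and> z \<in> Y \<and> set p \<inter> Y = {}"
    using assms(1)
  proof (induction rule: converse_rtrancl_induct)
    case base
    show ?case using assms(2) by (intro exI[of _ "[]"] exI[of _ y]) (auto simp: path_in_def)
  next
    case (step x x')
    then obtain p z where p: "path_in R (p @ [z])" "hd (p @ [z]) = x'" "z \<in> Y" "set p \<inter> Y = {}"
      by blast
    consider "x \<in> Y" | "x \<notin> Y" "x \<in> set p" | "x \<notin> Y" "x \<notin> set p" by blast
    then show ?case
    proof cases
      case 1
      then show ?thesis by (intro exI[of _ "[]"] exI[of _ x]) (auto simp: path_in_def)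
    next
      \<comment> \<open>The new start \<open>x\<close> already lies on the path, so the loop back to
        \<open>x\<close> is cut off.\<close>
      case 2
      then obtain p1 p2 where "p = p1 @ x # p2" by (auto simp: in_set_conv_decomp)
      then show ?thesis using p
        by (intro exI[of _ "x # p2"] exI[of _ z]) (auto simp: path_in_def successively_append_iff)
    next
      case 3
      have "successively (\<lambda>x y. (x, y) \<in> R) (x # p @ [z])"
        using p(1,2) step(1) by (cases "p @ [z]") (auto simp: path_in_def)
      then show ?thesis using p 3
        by (intro exI[of _ "x # p"] exI[of _ z]) (auto simp: path_in_def)
    qed
  qed
  then show thesis using that by blast
qed

lemma path_in_mono:
  assumes "path_in E p" "E \<subseteq> F"
  shows "path_in F p"
  using assms successively_mono[of "\<lambda>x y. (x, y) \<in> E" p "\<lambda>x y. (x, y) \<in> F"]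
  by (auto simp: path_in_def)

text \<open>The endpoint \<open>z\<close> is left out because for \<open>p = []\<close> the path has
  no edge and nothing forces \<open>z\<close> into \<open>A\<close>.\<close>

lemma path_in_Restr_subset:
  assumes "path_in (Restr E A) (p @ [z])"
  shows "set p \<subseteq> A"
  using assms
proof (induction p)
  case (Cons x p)
  then show ?case by (cases p) (auto simp: path_in_def)
qed simp

section \<open>Even degrees put every edge on a cycle\<close>

lemma even_card_sym_irrefl:
  assumes "finite E" "sym E" "irrefl E"
  shows "even (card E)"
  using assms
proof (induction "card E" arbitrary: E rule: less_induct)
  case less
  show ?case
  proof (cases "E = {}")
    case False
    then obtain a b where ab: "(a, b) \<in> E" by auto
    then have ba: "(b, a) \<in> E" "a \<noteq> b" using less.prems by (auto dest: symD irreflD)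
    let ?F = "E - {(a, b), (b, a)}"
    have card: "card E = card ?F + 2"
      using ab ba less.prems(1) card_Diff_subset[of "{(a, b), (b, a)}" E]
        card_mono[of E "{(a, b), (b, a)}"] by auto
    have "even (card ?F)"
      using less.prems card by (intro less.hyps) (auto simp: sym_def irrefl_def)
    then show ?thesis using card by simp
  qed simp
qed

lemma edge_on_cycle:
  assumes fin: "finite E" and sym: "sym E" and irr: "irrefl E"
    and even: "\<And>x. even (card (E `` {x}))"
    and uv: "(u, v) \<in> E"
  obtains C where "cycle_in E C" "u \<in> set C" "v \<in> set C"
proof -
  let ?F = "E - {(u, v), (v, u)}"
  let ?S = "?F\<^sup>* `` {u}"
  have "u \<noteq> v" using irr uv by (auto dest: irreflD)
  have symF: "sym ?F" using sym by (auto simp: sym_def)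
  have "v \<in> ?S"
  proof (rule ccontr)
    assume v: "v \<notin> ?S"
    have finS: "finite ?S"
    proof (rule finite_subset)
      show "?S \<subseteq> insert u (Range E)" by (auto elim: rtranclE)
      show "finite (insert u (Range E))" using fin by (simp add: finite_Range)
    qed
    \<comment> \<open>As \<open>v\<close> is outside the component \<open>?S\<close> of
      \<open>u\<close>, the vertex \<open>u\<close> is the only one in \<open>?S\<close> that loses
      a neighbour.\<close>
    have deg: "even (card (?F `` {x})) \<longleftrightarrow> x \<noteq> u" if "x \<in> ?S" for x
    proof (cases "x = u")
      case True
      have "?F `` {u} = E `` {u} - {v}" using \<open>u \<noteq> v\<close> by auto
      moreover have "finite (E `` {u})" "v \<in> E `` {u}" using fin uv by (auto simp: finite_Image)
      ultimately have "Suc (card (?F `` {u})) = card (E `` {u})" by (metis card_Suc_Diff1)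
      then show ?thesis using even[of u] True by (metis even_Suc)
    next
      case False
      then have "x \<noteq> v" using that v by auto
      then have "?F `` {x} = E `` {x}" using False by auto
      then show ?thesis using even False by simp
    qed
    \<comment> \<open>Handshake count: the degrees in \<open>?S\<close> add up to the number of
      ordered pairs inside \<open>?S\<close>. Exactly one degree is odd, but symmetric pairs without
      loops are even in number.\<close>
    have "Restr ?F ?S = (SIGMA x : ?S. ?F `` {x})" by (auto intro: rtrancl_into_rtrancl)
    then have "card (Restr ?F ?S) = (\<Sum>x\<in>?S. card (?F `` {x}))"
      using finS fin by (simp add: finite_Image)
    also have "\<dots> = card (?F `` {u}) + (\<Sum>x\<in>?S - {u}. card (?F `` {x}))"
      using finS by (intro sum.remove) auto
    finally have "card (Restr ?F ?S) = card (?F `` {u}) + (\<Sum>x\<in>?S - {u}. card (?F `` {x}))" .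
    moreover have "even (\<Sum>x\<in>?S - {u}. card (?F `` {x}))"
      using deg by (intro dvd_sum) auto
    moreover have "odd (card (?F `` {u}))" using deg[of u] by auto
    moreover have "even (card (Restr ?F ?S))"
    proof (rule even_card_sym_irrefl)
      show "sym (Restr ?F ?S)" using symF by (auto simp: sym_def)
      show "irrefl (Restr ?F ?S)" using irr by (auto simp: irrefl_def)
    qed (use fin in auto)
    ultimately show False by simp
  qed
  then obtain p z where p: "path_in ?F (p @ [z])" "hd (p @ [z]) = u" "z \<in> {v}"
    using path_to_set[of u v ?F "{v}"] by blast
  then have z: "z = v" by simp
  have u: "u \<in> set (p @ [v])" using p(2) z hd_in_set[of "p @ [v]"] by simp
  \<comment> \<open>The edge \<open>uv\<close> was removed, so the path from \<open>u\<close> to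
    \<open>v\<close> has an inner vertex and closing it by \<open>uv\<close> gives a genuine
    cycle.\<close>
  have "3 \<le> length (p @ [v])"
  proof -
    obtain q where "p = u # q" using p(2) z \<open>u \<noteq> v\<close> by (cases p) auto
    moreover have "q \<noteq> []" using p(1) z calculation by (auto simp: path_in_def)
    ultimately show ?thesis by (cases q) auto
  qed
  moreover have "path_in E (p @ [v])" using p z path_in_mono[of ?F _ E] by blast
  moreover have "(v, u) \<in> E" using uv sym by (auto dest: symD)
  ultimately have "cycle_in E (p @ [v])" using p(2) z by (simp add: cycle_in_def)
  then show thesis using that u by simp
qed

section \<open>Ears of a cycle and lengths modulo 4\<close>

lemma ear_makes_theta:
  assumes "sym E" and C: "cycle_in E (a # s @ y # t)"
    and ear: "path_in E (a # m @ [y])" "set m \<inter> set (a # s @ y # t) = {}"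
    and "m \<noteq> [] \<or> s \<noteq> [] \<and> t \<noteq> []"
  shows "cycle_in E (a # m @ y # t)" "cycle_in E (a # s @ y # rev m)"
proof -
  have sym: "(q, p) \<in> E \<longleftrightarrow> (p, q) \<in> E" for p q using assms(1) by (auto dest: symD)
  \<comment> \<open>The last hypothesis says that the ear is not an edge of the cycle itself; this
    leaves at least three vertices on both new cycles.\<close>
  have len: "3 \<le> length (a # m @ y # t)" "3 \<le> length (a # s @ y # rev m)"
    using assms(5) by (cases m; cases s; cases t; simp)+
  show "cycle_in E (a # m @ y # t)"
    using len(1) C ear
    by (auto simp: cycle_in_def path_in_def successively_append_iff successively_Cons
        hd_append split: if_splits)
  \<comment> \<open>Here the ear is traversed backwards, which uses symmetry of
    \<open>E\<close>.\<close>
  show "cycle_in E (a # s @ y # rev m)"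
    using len(2) C ear
    by (auto simp: cycle_in_def path_in_def successively_append_iff successively_Cons sym
        hd_append last_append hd_rev last_rev split: if_splits)
qed

lemma no_ear_mod_4:
  assumes "sym E" and mod4: "\<And>D. cycle_in E D \<Longrightarrow> length D mod 4 = 3"
    and C: "cycle_in E (a # s @ y # t)"
    and ear: "path_in E (a # m @ [y])" "set m \<inter> set (a # s @ y # t) = {}"
  shows "m = [] \<and> (s = [] \<or> t = [])"
proof (rule ccontr)
  assume "\<not> ?thesis"
  then have "m \<noteq> [] \<or> s \<noteq> [] \<and> t \<noteq> []" by blast
  from ear_makes_theta[OF assms(1) C ear this]
  have "(length m + length t + 2) mod 4 = 3" "(length s + length m + 2) mod 4 = 3"
    "(length s + length t + 2) mod 4 = 3"
    using mod4 C by fastforce+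
  \<comment> \<open>The first two sums minus the third give \<open>2 * length m + 2\<close>, an even
    number that would have to be 3 modulo 4.\<close>
  then show False by presburger
qed

text \<open>A chord is an ear without inner vertices, so one of the two arcs of the cycle between
  its ends has no inner vertex either, and the ends are neighbours on the cycle.\<close>

lemma chord_free_mod_4:
  assumes "sym E" "irrefl E" and mod4: "\<And>D. cycle_in E D \<Longrightarrow> length D mod 4 = 3"
    and C: "cycle_in E C" and ij: "i < length C" "j < length C" and e: "(C ! i, C ! j) \<in> E"
  shows "j = Suc i mod length C \<or> i = Suc j mod length C"
proof -
  let ?n = "length C"
  have dist: "distinct C" using C by (simp add: cycle_in_def path_in_def)
  have "cycle_in E (rotate i C)"
    using cycle_in_rotate[of E "take i C" "drop i C"] C ij(1) by (simp add: rotate_drop_take)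
  moreover have "rotate i C \<noteq> []" "hd (rotate i C) = C ! i"
    using ij hd_rotate_conv_nth[of C i] by (cases "C = []"; simp)+
  ultimately obtain D where D: "rotate i C = C ! i # D" "cycle_in E (C ! i # D)"
    by (metis list.collapse)
  have ne: "C ! i \<noteq> C ! j" using e assms(2) by (metis irreflD)
  have "C ! j \<in> set (rotate i C)" using ij by simp
  then have "C ! j \<in> set D" using D ne by simp
  then obtain s t where st: "D = s @ C ! j # t" by (auto simp: in_set_conv_decomp)
  have "path_in E (C ! i # [] @ [C ! j])" using e ne by (auto simp: path_in_def)
  from no_ear_mod_4[OF assms(1) mod4 _ this, of s t] D st have st_empty: "s = [] \<or> t = []" by auto
  have nth: "rotate i C ! k = C ! ((i + k) mod ?n)" if "k < ?n" for k
    using that by (simp add: nth_rotate add.commute)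
  have n: "?n = length s + length t + 2" using D(1) st length_rotate[of i C] by simp
  have "C ! j = rotate i C ! (length s + 1)" using D(1) st by (simp add: nth_append)
  also have "\<dots> = C ! ((i + (length s + 1)) mod ?n)" using n by (intro nth) simp
  \<comment> \<open>After rotation by \<open>i\<close>, the vertex \<open>C ! j\<close> stands at
    position \<open>length s + 1\<close>. If \<open>s = []\<close>, it follows \<open>C ! i\<close>;
    if \<open>t = []\<close>, this position is \<open>?n - 1\<close>, and it precedes
    \<open>C ! i\<close> cyclically.\<close>
  finally have j: "j = (i + (length s + 1)) mod ?n"
    using dist ij nth_eq_iff_index_eq[of C] n by simp
  show ?thesis
  proof (cases "s = []")
    case False
    then have "t = []" using st_empty by blast
    then have "Suc j mod ?n = (i + ?n) mod ?n" using j n by (simp add: mod_Suc_eq)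
    then show ?thesis using ij by simp
  qed (use j in simp)
qed

text \<open>Otherwise connectivity of \<open>W\<close> gives an edge from some \<open>a\<close> on
  the cycle to some \<open>b\<close> off it, and connectivity of \<open>W - {a}\<close> leads from
  \<open>b\<close> back to the cycle while avoiding \<open>a\<close>. Together they form an ear with
  inner vertex \<open>b\<close>.\<close>

lemma biconnected_subset_cycle_mod_4:
  assumes "sym E" and mod4: "\<And>D. cycle_in E D \<Longrightarrow> length D mod 4 = 3"
    and W: "biconnected_on E W" and C: "cycle_in E C" "set C \<subseteq> W"
  shows "W = set C"
proof (rule ccontr)
  assume "W \<noteq> set C"
  then obtain w where w: "w \<in> W" "w \<notin> set C" using C by blast
  have "C \<noteq> []" using C by (auto simp: cycle_in_def)
  then obtain c where c: "c \<in> set C" by (cases C) auto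
  have "(c, w) \<in> (Restr E W)\<^sup>*" using W w c C by (auto simp: biconnected_on_def intro: connected_onD)
  then have "\<exists>a b. (a, b) \<in> E \<and> a \<in> set C \<and> b \<in> W - set C"
    using c w
  proof (induction rule: converse_rtrancl_induct)
    case (step x x')
    then show ?case by (cases "x' \<in> set C") auto
  qed simp
  then obtain a b where ab: "(a, b) \<in> E" "a \<in> set C" "b \<in> W" "b \<notin> set C" by auto
  obtain D where D: "cycle_in E (a # D)" "set (a # D) = set C"
    using cycle_in_rotate_hd C(1) ab(2) by metis
  have aD: "a \<notin> set D" using D by (auto simp: cycle_in_def path_in_def)
  have "D \<noteq> []" using D by (auto simp: cycle_in_def)
  then obtain d where d: "d \<in> set D" by (cases D) auto
  then have "d \<in> W - {a}" "b \<in> W - {a}" using aD D C ab by auto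
  then have "(b, d) \<in> (Restr E (W - {a}))\<^sup>*" using W by (auto simp: biconnected_on_def intro: connected_onD)
  then obtain p y where p: "path_in (Restr E (W - {a})) (p @ [y])" "hd (p @ [y]) = b" "y \<in> set D"
    "set p \<inter> set D = {}"
    using path_to_set[of b d "Restr E (W - {a})" "set D"] d by blast
  have "p \<noteq> []" using p(2,3) ab(4) D(2)
    by (metis append_Nil list.sel(1) list.set_intros(2))
  have "a \<notin> set p" using path_in_Restr_subset[OF p(1)] by auto
  moreover have "path_in E (p @ [y])" using p(1) path_in_mono[of _ _ E] by blast
  ultimately have ear: "path_in E (a # p @ [y])"
    using ab(1) p(2,3) aD \<open>p \<noteq> []\<close>
    by (auto simp: path_in_def successively_Cons)
  obtain s t where st: "D = s @ y # t" using p(3) by (auto simp: in_set_conv_decomp)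
  have "p = []"
    using no_ear_mod_4[OF assms(1) mod4, of a s y t p] D(1) ear p(4) \<open>a \<notin> set p\<close> st by auto
  then show False using \<open>p \<noteq> []\<close> by contradiction
qed

section \<open>From digraphs to relations and vertex lists\<close>

lemma (in wf_digraph) Restr_arcs_ends_verts: "Restr (arcs_ends G) (verts G) = arcs_ends G"
  by (auto simp: arcs_ends_conv)

lemma (in wf_digraph) connected_on_arcs_ends_iff_reachable:
  "connected_on (arcs_ends G) (verts G) \<longleftrightarrow> (\<forall>u \<in> verts G. \<forall>v \<in> verts G. u \<rightarrow>\<^sup>* v)"
  unfolding connected_on_def Restr_arcs_ends_verts by (auto simp: reachable_conv)

lemma (in sym_digraph) connected_iff_connected_on:
  "Digraph_Component.connected G \<longleftrightarrow> verts G \<noteq> {} \<and> connected_on (arcs_ends G) (verts G)"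
  unfolding Digraph_Component.connected_def strongly_connected_def connected_on_arcs_ends_iff_reachable
  using reachable_mk_symmetric_eq[OF sym_arcs] by simp

text \<open>By symmetry, reachability in one direction already makes two components equal. The bound
  is \<open>\<le> 1\<close> rather than \<open>= 1\<close> to cover the empty graph left when an
  only vertex is deleted.\<close>

lemma (in pseudo_graph) card_sccs_le_1_iff:
  "card sccs \<le> 1 \<longleftrightarrow> connected_on (arcs_ends G) (verts G)"
proof -
  have "card sccs \<le> 1 \<longleftrightarrow> card (scc_of ` verts G) \<le> Suc 0"
    using card_sccs_verts by (simp add: sccs_verts_conv_scc_of)
  also have "\<dots> \<longleftrightarrow> (\<forall>u \<in> verts G. \<forall>v \<in> verts G. scc_of u = scc_of v)"
    by (subst card_le_Suc0_iff_eq) auto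
  also have "\<dots> \<longleftrightarrow> (\<forall>u \<in> verts G. \<forall>v \<in> verts G. u \<rightarrow>\<^sup>* v)"
  proof (intro ball_cong refl iffI)
    fix u v assume v: "v \<in> verts G"
    { assume "scc_of u = scc_of v"
      then show "u \<rightarrow>\<^sup>* v" using in_scc_of_self[OF v] by (auto simp: scc_of_def) }
    { assume "u \<rightarrow>\<^sup>* v"
      then show "scc_of u = scc_of v"
        using symmetric_reachable[OF sym_arcs] by (auto simp: scc_of_def intro: reachable_trans) }
  qed
  finally show ?thesis by (simp add: connected_on_arcs_ends_iff_reachable)
qed

lemma (in pseudo_graph) pseudo_graph_del_vert: "pseudo_graph (del_vert x)"
proof -
  interpret D: fin_digraph "del_vert x" by (rule fin_digraph_del_vert)
  have "symmetric (del_vert x)"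
    using sym_arcs by (auto simp: symmetric_conv del_vert_simps)
  then show ?thesis by unfold_locales
qed

text \<open>A connected graph has exactly one component, so a vertex is a cut vertex just when its
  deletion leaves more than one.\<close>

lemma (in graph) biconnected_iff_no_cut_vertex:
  "Digraph_Component.connected G \<and> (\<nexists>x. cut_vertex G x) \<longleftrightarrow>
    verts G \<noteq> {} \<and> biconnected_on (arcs_ends G) (verts G)"
proof (cases "Digraph_Component.connected G")
  case True
  then have conn: "verts G \<noteq> {}" "connected_on (arcs_ends G) (verts G)"
    by (auto simp: connected_iff_connected_on)
  have "sccs_verts \<noteq> {}" using conn(1) by (simp add: sccs_verts_conv_scc_of)
  then have "card sccs \<noteq> 0" using finite_sccs_verts card_sccs_verts by (metis card_0_eq)
  moreover have "card sccs \<le> 1" using conn(2) by (simp only: card_sccs_le_1_iff)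
  ultimately have one: "card sccs = 1" by simp
  have "cut_vertex G x \<longleftrightarrow> \<not> connected_on (arcs_ends G) (verts G - {x})" for x
  proof (cases "x \<in> verts G")
    case True
    interpret D: pseudo_graph "del_vert x" by (rule pseudo_graph_del_vert)
    have "Restr (arcs_ends (del_vert x)) (verts G - {x}) = Restr (arcs_ends G) (verts G - {x})"
      by (auto simp: arcs_ends_conv del_vert_simps)
    then have "connected_on (arcs_ends (del_vert x)) (verts (del_vert x)) \<longleftrightarrow>
        connected_on (arcs_ends G) (verts G - {x})"
      by (simp only: connected_on_def verts_del_vert)
    then show ?thesis
      using D.card_sccs_le_1_iff True one unfolding cut_vertex_def by (metis not_le)
  next
    \<comment> \<open>For \<open>x\<close> outside the graph both sides are false, since
      \<open>verts G - {x}\<close> is all of \<open>verts G\<close>.\<close>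
    case False
    then show ?thesis using conn by (simp add: cut_vertex_def)
  qed
  then show ?thesis using True conn by (simp add: biconnected_on_def)
next
  case False
  then show ?thesis by (auto simp: connected_iff_connected_on biconnected_on_def)
qed

lemma (in digraph) card_arcs_ends_Image: "card (arcs_ends G `` {v}) = out_degree G v"
proof -
  have "inj_on (head G) (out_arcs G v)"
    using no_multi_arcs by (auto simp: inj_on_def out_arcs_def arc_to_ends_def)
  moreover have "arcs_ends G `` {v} = head G ` out_arcs G v"
    by (auto simp: arcs_ends_conv out_arcs_def)
  ultimately show ?thesis by (simp add: out_degree_def card_image)
qed

lemma (in wf_digraph) awalk_of_successively:
  assumes "successively (\<lambda>x y. (x, y) \<in> arcs_ends G) (u # xs)" "u \<in> verts G"
  shows "\<exists>p. awalk u p (last (u # xs)) \<and> awalk_verts u p = u # xs"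
  using assms
proof (induction xs arbitrary: u)
  case Nil
  then show ?case by (intro exI[of _ "[]"]) (auto simp: awalk_Nil_iff)
next
  case (Cons x xs)
  then obtain e where e: "e \<in> arcs G" "tail G e = u" "head G e = x"
    by (auto simp: arcs_ends_conv)
  then have "x \<in> verts G" by auto
  then obtain p where "awalk x p (last (x # xs))" "awalk_verts x p = x # xs"
    using Cons by auto
  then show ?case using e
    by (intro exI[of _ "e # p"]) (auto simp: awalk_Cons_iff)
qed

text \<open>This carries the hypothesis on cycle lengths from arc walks over to vertex
  lists.\<close>

lemma (in wf_digraph) ucycle_of_cycle_in:
  assumes C: "cycle_in (arcs_ends G) C"
  obtains p where "ucycle G p" "length p = length C"
proof -
  have "C \<noteq> []" using C by (auto simp: cycle_in_def)
  then obtain u D where uD: "C = u # D" by (cases C) auto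
  have "D \<noteq> []" using C uD by (auto simp: cycle_in_def)
  have "(last C, u) \<in> arcs_ends G" using C uD by (simp add: cycle_in_def)
  then have u: "u \<in> verts G" by (auto simp: arcs_ends_conv)
  \<comment> \<open>Repeating \<open>u\<close> at the end closes the walk; having one arc fewer than
    listed vertices, it has \<open>length C\<close> arcs.\<close>
  have "successively (\<lambda>x y. (x, y) \<in> arcs_ends G) (u # D @ [u])"
    using C uD \<open>D \<noteq> []\<close>
    by (auto simp: cycle_in_def path_in_def successively_Cons successively_append_iff)
  from awalk_of_successively[OF this u]
  obtain p where p: "awalk u p u" "awalk_verts u p = u # D @ [u]" by auto
  have len: "length p = length C"
    using length_awalk_verts[of u p] p(2) uD by simp
  moreover have "cycle p" unfolding cycle_def
    using p C uD len by (intro exI[of _ u]) (auto simp: cycle_in_def path_in_def)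
  ultimately show thesis using that C by (auto simp: ucycle_def cycle_in_def)
qed

section \<open>Recognizing a cycle graph\<close>

lemma digraph_iso_cycle_graph:
  assumes "digraph B" and C: "distinct C" "set C = verts B"
    and arcs: "\<And>i j. \<lbrakk>i < length C; j < length C\<rbrakk> \<Longrightarrow> (C ! i, C ! j) \<in> arcs_ends B \<longleftrightarrow>
      j = Suc i mod length C \<or> i = Suc j mod length C"
  shows "digraph_iso B (cycle_graph (length C))"
proof -
  interpret B: digraph B by fact
  let ?n = "length C"
  \<comment> \<open>The isomorphism sends a vertex to its position in \<open>C\<close>, and an arc
    to the pair of positions of its ends; the latter is injective because there are no parallel
    arcs.\<close>
  define f where "f = the_inv_into {..<?n} ((!) C)"
  have bij: "bij_betw ((!) C) {..<?n} (verts B)"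
    using C bij_betw_nth[of C "{..<?n}" "verts B"] by simp
  have f: "bij_betw f (verts B) {..<?n}" unfolding f_def using bij by (rule bij_betw_the_inv_into)
  have Cf: "C ! f x = x" if "x \<in> verts B" for x
    using that bij f_the_inv_into_f_bij_betw[of "(!) C"] by (auto simp: f_def)
  have fC: "f (C ! i) = i" if "i < ?n" for i
    using that bij by (auto simp: f_def bij_betw_def intro: the_inv_into_f_f)
  have f_less: "f x < ?n" if "x \<in> verts B" for x using f that by (auto simp: bij_betw_def)
  let ?hom = "\<lparr>iso_verts = f, iso_arcs = (\<lambda>e. (f (tail B e), f (head B e))),
    iso_head = snd, iso_tail = fst\<rparr>"
  have inj: "inj_on f (verts B)" using f by (simp add: bij_betw_def)
  have "inj_on (\<lambda>e. (f (tail B e), f (head B e))) (arcs B)"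
    using inj B.no_multi_arcs
    by (auto simp: inj_on_def arc_to_ends_def)
  then have "B.digraph_isomorphism ?hom"
    using inj by (auto simp: B.digraph_isomorphism_def B.wf_digraph)
  moreover have "(\<lambda>e. (f (tail B e), f (head B e))) ` arcs B =
      {(i, j). i < ?n \<and> j < ?n \<and> (j = Suc i mod ?n \<or> i = Suc j mod ?n)}" (is "?L = ?R")
  proof (intro equalityI subrelI)
    fix i j assume "(i, j) \<in> ?L"
    then obtain e where e: "e \<in> arcs B" "i = f (tail B e)" "j = f (head B e)" by auto
    then have "i < ?n" "j < ?n" "(C ! i, C ! j) \<in> arcs_ends B"
      using f_less Cf by (auto simp: arcs_ends_conv)
    then show "(i, j) \<in> ?R" using arcs by auto
  next
    fix i j assume ij: "(i, j) \<in> ?R"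
    then have "(C ! i, C ! j) \<in> arcs_ends B" using arcs by auto
    then obtain e where "e \<in> arcs B" "tail B e = C ! i" "head B e = C ! j"
      by (auto simp: arcs_ends_conv)
    then show "(i, j) \<in> ?L" using fC ij by (auto simp: image_iff intro!: bexI[of _ e])
  qed
  then have "cycle_graph ?n = app_iso ?hom B"
    using f by (simp add: cycle_graph_def with_proj_def app_iso_def bij_betw_def)
  ultimately show ?thesis unfolding digraph_iso_def by blast
qed

lemma cycle_in_nth_Suc:
  assumes "cycle_in E C" "i < length C"
  shows "(C ! i, C ! (Suc i mod length C)) \<in> E"
proof (cases "Suc i < length C")
  case True
  then show ?thesis using assms by (simp add: cycle_in_def path_in_def successively_conv_nth)
next
  case False
  then have "Suc i = length C" using assms(2) by simp
  then have "i = length C - 1" "Suc i mod length C = 0" "C \<noteq> []" by auto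
  then show ?thesis using assms(1) by (simp add: cycle_in_def last_conv_nth hd_conv_nth)
qed

section \<open>Blocks are induced cycles\<close>

lemma (in graph) block_eq_induced:
  assumes B: "block B G" and W: "verts B \<subseteq> W" "W \<subseteq> verts G" "biconnected_on (arcs_ends G) W"
  shows "B = G \<restriction> W"
proof (rule ccontr)
  assume ne: "B \<noteq> G \<restriction> W"
  have sub: "subgraph B G" and "Digraph_Component.connected B"
    and max: "\<And>H. \<lbrakk>H \<noteq> B; subgraph B H; subgraph H G; graph H\<rbrakk> \<Longrightarrow>
      \<not> (Digraph_Component.connected H \<and> (\<nexists>v. cut_vertex H v))"
    using B by (auto simp: block_def max_subgraph_def)
  have "verts B \<noteq> {}"
    using \<open>Digraph_Component.connected B\<close>
    by (simp add: Digraph_Component.connected_def strongly_connected_def)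
  \<comment> \<open>The graph \<open>G \<restriction> W\<close> contains \<open>B\<close> and is
    again connected without cut vertices, so a difference from \<open>B\<close> would contradict
    maximality.\<close>
  have ind: "induced_subgraph (G \<restriction> W) G" using W(2) by (rule induced_induce)
  interpret H: graph "G \<restriction> W"
    using digraphI_induced[OF ind] induced_graph_imp_symmetric[OF sym_arcs ind]
    by (rule digraph.graphI)
  have "Restr (arcs_ends (G \<restriction> W)) A = Restr (arcs_ends G) A" if "A \<subseteq> W" for A
    using that by (auto simp: arcs_ends_conv)
  then have "biconnected_on (arcs_ends (G \<restriction> W)) W"
    using W(3) by (simp add: biconnected_on_def connected_on_def Diff_subset)
  then have "Digraph_Component.connected (G \<restriction> W) \<and> (\<nexists>v. cut_vertex (G \<restriction> W) v)"
    using H.biconnected_iff_no_cut_vertex \<open>verts B \<noteq> {}\<close> W(1) by auto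
  moreover have "subgraph B (G \<restriction> W)"
  proof (rule subgraphI)
    show "compatible (G \<restriction> W) B" using sub by (auto simp: compatible_def)
    show "wf_digraph B" using sub by auto
    show "verts B \<subseteq> verts (G \<restriction> W)" using W by simp
    have "tail G e \<in> verts B \<and> head G e \<in> verts B" if "e \<in> arcs B" for e
      using sub that wf_digraph.wellformed[of B e] by (auto simp: subgraph_def compatible_def)
    then show "arcs B \<subseteq> arcs (G \<restriction> W)" using sub W by auto
  qed (rule H.wf_digraph)
  ultimately show False
    using max[of "G \<restriction> W"] ne induced_imp_subgraph[OF ind] H.graph_axioms by blast
qed

theorem theorem17:
  fixes G B :: "('a, 'b) pre_digraph"
  assumes "G \<in> euler_graphs_3"
    and "2 \<le> card (verts G)"
    and "block B G"
  shows "\<exists>n. n mod 4 = 3 \<and> digraph_iso B (cycle_graph n)"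
proof -
  have "graph G" "Digraph_Component.connected G"
    and deg: "\<And>v. v \<in> verts G \<Longrightarrow> even (out_degree G v)"
    and len: "\<And>p. ucycle G p \<Longrightarrow> length p mod 4 = 3"
    using assms(1) by (auto simp: euler_graphs_3_def euler_graph_def)
  interpret graph G by fact
  let ?E = "arcs_ends G"
  have finE: "finite ?E" by (simp add: arcs_ends_conv)
  have symE: "sym ?E" using sym_arcs by (simp add: symmetric_def)
  have irrE: "irrefl ?E" using no_loops by (auto simp: irrefl_def arcs_ends_conv)
  have evenE: "even (card (?E `` {v}))" for v
  proof (cases "v \<in> verts G")
    case False
    then have "?E `` {v} = {}" by (auto simp: arcs_ends_conv)
    then show ?thesis by simp
  qed (use deg in \<open>simp add: card_arcs_ends_Image\<close>)
  have mod4: "length C mod 4 = 3" if "cycle_in ?E C" for C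
    using that ucycle_of_cycle_in len by metis
  have cycle_verts: "set C \<subseteq> verts G" if cyc: "cycle_in ?E C" for C
  proof
    fix x assume "x \<in> set C"
    then obtain D where "cycle_in ?E (x # D)" using cycle_in_rotate_hd[OF cyc] by blast
    then have "(last (x # D), x) \<in> ?E" by (simp add: cycle_in_def)
    then show "x \<in> verts G" by (auto simp: arcs_ends_conv)
  qed

  let ?W = "verts B"
  have sub: "subgraph B G" and "graph B"
    and conB: "Digraph_Component.connected B \<and> (\<nexists>v. cut_vertex B v)"
    using assms(3) by (auto simp: block_def max_subgraph_def)
  have WV: "?W \<subseteq> verts G" using sub by auto
  have "biconnected_on (arcs_ends B) ?W" "?W \<noteq> {}"
    using graph.biconnected_iff_no_cut_vertex[OF \<open>graph B\<close>] conB by auto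
  then have W: "biconnected_on ?E ?W"
    using connected_on_mono[OF _ arcs_ends_mono[OF sub]] by (auto simp: biconnected_on_def)
  obtain u where u: "u \<in> ?W" using \<open>?W \<noteq> {}\<close> by blast

  have nbr: "\<exists>w. (u, w) \<in> Restr ?E A" if "connected_on ?E A" "u \<in> A" "v \<in> A" "v \<noteq> u" for A v
    using connected_onD[OF that(1-3)] that(4) by (metis converse_rtranclE)
  \<comment> \<open>The neighbour \<open>w\<close> is taken inside the block if possible, so that a
    cycle through \<open>uw\<close> meets the block twice. If the block is only \<open>u\<close>,
    then \<open>w\<close> comes from connectivity of \<open>G\<close>, which has a second
    vertex.\<close>
  obtain w where w: "(u, w) \<in> ?E" "?W = {u} \<or> w \<in> ?W"
  proof (cases "?W = {u}")
    case True
    have "verts G \<noteq> {u}" using assms(2) by auto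
    then obtain v where "v \<in> verts G" "v \<noteq> u" using u WV by blast
    moreover have "connected_on ?E (verts G)"
      using \<open>Digraph_Component.connected G\<close> by (simp add: connected_iff_connected_on)
    ultimately show thesis using nbr[of "verts G" v] u WV that True by blast
  next
    case False
    then obtain v where "v \<in> ?W" "v \<noteq> u" using u by blast
    then show thesis using nbr[of ?W v] u W that by (auto simp: biconnected_on_def)
  qed
  obtain C where C: "cycle_in ?E C" "u \<in> set C" "w \<in> set C"
    using edge_on_cycle[OF finE symE irrE evenE w(1)] by blast
  have "w \<noteq> u" using w(1) irrE by (auto dest: irreflD)
  then have U: "biconnected_on ?E (?W \<union> set C)"
    using biconnected_on_Un_cycle[OF symE W C(1) u C(2)] w(2) C(3) by blast
  have B: "B = G \<restriction> (?W \<union> set C)"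
    using block_eq_induced[OF assms(3) _ _ U] WV cycle_verts[OF C(1)] by blast
  \<comment> \<open>The enlarged set is biconnected and contains the cycle \<open>C\<close>, hence
    has no vertex off \<open>C\<close>.\<close>
  have WC: "?W \<union> set C = set C"
    by (rule biconnected_subset_cycle_mod_4[OF symE mod4 U C(1)]) auto
  then have B_eq: "B = G \<restriction> set C" using B by simp
  have "digraph_iso B (cycle_graph (length C))"
  proof (rule digraph_iso_cycle_graph)
    show "digraph B" using \<open>graph B\<close> by (simp add: graph_def)
    show "distinct C" using C(1) by (simp add: cycle_in_def path_in_def)
    show "set C = verts B" using B_eq by simp
    fix i j assume ij: "i < length C" "j < length C"
    then have "C ! i \<in> set C" "C ! j \<in> set C" by simp_all
    \<comment> \<open>The block is induced, so its arcs are those of \<open>G\<close> between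
      vertices of \<open>C\<close>: the edges of \<open>C\<close> and no chords.\<close>
    then have "(C ! i, C ! j) \<in> arcs_ends B \<longleftrightarrow> (C ! i, C ! j) \<in> ?E"
      unfolding B_eq by (auto simp: arcs_ends_conv image_iff)
    then show "(C ! i, C ! j) \<in> arcs_ends B \<longleftrightarrow>
        j = Suc i mod length C \<or> i = Suc j mod length C"
      using chord_free_mod_4[OF symE irrE mod4 C(1) ij] cycle_in_nth_Suc[OF C(1)] ij symE
      by (auto dest: symD)
  qed
  then show ?thesis using mod4[OF C(1)] by blast
qed

end
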